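(* The logic $\mathbf{IL}^-(\mathbf{P})$ has $\ell$FPP. That is, for every propositional variable $p$ and every $\mathcal{L}(\rhd)$-formula $A(p)$ in which $p$ is left-modalized, there exists an $\mathcal{L}(\rhd)$-formula $F$ such that $\mathrm{var}(F) \subseteq \mathrm{var}(A(p)) \setminus \{p\}$ and $\mathbf{IL}^-(\mathbf{P}) \vdash F \leftrightarrow A(F)$.
   Context: The language $\mathcal{L}(\rhd)$ has countably many propositional variables, the constant $\bot$, connectives $\neg, \land, \lor, \to$, a unary modal operator $\Box$ and a binary modal operator $\rhd$; $\top := \neg\bot$, $\Diamond := \neg\Box\neg$. The logic $\mathbf{IL}^-(\mathbf{P})$ has as axioms: all tautologies in $\mathcal{L}(\rhd)$; $\Box(A \to B) \to (\Box A \to \Box B)$; $\Box(\Box A \to A) \to \Box A$; $\mathbf{J3}$: $(A \rhd C) \land (B \rhd C) \to (A \lor B) \rhd C$; $\mathbf{J6}$: $\Box A \leftrightarrow (\neg A) \rhd \bot$; and the persistence principle $\mathbf{P}$: $A \rhd B \to \Box(A \rhd B)$ (all as schemes). Its inference rules are Modus Ponens, Necessitation ($A / \Box A$), $\mathbf{R1}$: from $A \to B$ infer $C \rhd A \to C \rhd B$, and $\mathbf{R2}$: from $A \to B$ infer $B \rhd C \to A \rhd C$. $\mathrm{var}(A)$ is the set of propositional variables occurring in $A$. A variable $p$ is modalized in $A$ if every occurrence of $p$ in $A$ is in the scope of some modal operator $\Box$ or $\rhd$. $p$ is left-modalized in $A$ if $p$ is modalized in $A$ and for every subformula $B \rhd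 C$ of $A$, $p \notin \mathrm{var}(C)$. $A(F)$ denotes the result of substituting $F$ for $p$ in $A(p)$. *)

theory Defs
  imports Main
begin

datatype fm =
    Var nat
  | Bot                 ("\<^bold>\<bottom>")
  | Neg fm              ("\<^bold>\<not> _" [80] 80)
  | Con fm fm           (infixr "\<^bold>\<and>" 65)
  | Dis fm fm           (infixr "\<^bold>\<or>" 60)
  | Imp fm fm           (infixr "\<^bold>\<rightarrow>" 55)
  | Box fm              ("\<^bold>\<box> _" [80] 80)
  | Rhd fm fm           (infix "\<rhd>" 70)

abbreviation Iff :: "fm \<Rightarrow> fm \<Rightarrow> fm" (infix "\<^bold>\<leftrightarrow>" 50) where
  "A \<^bold>\<leftrightarrow> B \<equiv> (A \<^bold>\<rightarrow> B) \<^bold>\<and> (B \<^bold>\<rightarrow> A)"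

primrec vars :: "fm \<Rightarrow> nat set" where
  "vars (Var q) = {q}"
| "vars \<^bold>\<bottom> = {}"
| "vars (\<^bold>\<not> A) = vars A"
| "vars (A \<^bold>\<and> B) = vars A \<union> vars B"
| "vars (A \<^bold>\<or> B) = vars A \<union> vars B"
| "vars (A \<^bold>\<rightarrow> B) = vars A \<union> vars B"
| "vars (\<^bold>\<box> A) = vars A"
| "vars (A \<rhd> B) = vars A \<union> vars B"

primrec subfms :: "fm \<Rightarrow> fm set" where
  "subfms (Var q) = {Var q}"
| "subfms \<^bold>\<bottom> = {\<^bold>\<bottom>}"
| "subfms (\<^bold>\<not> A) = insert (\<^bold>\<not> A) (subfms A)"
| "subfms (A \<^bold>\<and> B) = insert (A \<^bold>\<and> B) (subfms A \<union> subfms B)"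
| "subfms (A \<^bold>\<or> B) = insert (A \<^bold>\<or> B) (subfms A \<union> subfms B)"
| "subfms (A \<^bold>\<rightarrow> B) = insert (A \<^bold>\<rightarrow> B) (subfms A \<union> subfms B)"
| "subfms (\<^bold>\<box> A) = insert (\<^bold>\<box> A) (subfms A)"
| "subfms (A \<rhd> B) = insert (A \<rhd> B) (subfms A \<union> subfms B)"

text \<open>\<open>substitute p F A\<close> is $A(F)$: every occurrence of \<open>p\<close> in \<open>A\<close> is replaced by \<open>F\<close>.\<close>

primrec substitute :: "nat \<Rightarrow> fm \<Rightarrow> fm \<Rightarrow> fm" where
  "substitute p F (Var q) = (if q = p then F else Var q)"
| "substitute p F \<^bold>\<bottom> = \<^bold>\<bottom>"
| "substitute p F (\<^bold>\<not> A) = \<^bold>\<not> (substitute p F A)"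
| "substitute p F (A \<^bold>\<and> B) = substitute p F A \<^bold>\<and> substitute p F B"
| "substitute p F (A \<^bold>\<or> B) = substitute p F A \<^bold>\<or> substitute p F B"
| "substitute p F (A \<^bold>\<rightarrow> B) = substitute p F A \<^bold>\<rightarrow> substitute p F B"
| "substitute p F (\<^bold>\<box> A) = \<^bold>\<box> (substitute p F A)"
| "substitute p F (A \<rhd> B) = substitute p F A \<rhd> substitute p F B"

text \<open>No occurrence of \<open>p\<close> lies outside the scope of all modal operators; the modal cases are
  therefore unconditionally true, and the condition is vacuous if \<open>p\<close> does not occur.\<close>

primrec modalized :: "nat \<Rightarrow> fm \<Rightarrow> bool" where
  "modalized p (Var q) \<longleftrightarrow> q \<noteq> p"
| "modalized p \<^bold>\<bottom> \<longleftrightarrow> True"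
| "modalized p (\<^bold>\<not> A) \<longleftrightarrow> modalized p A"
| "modalized p (A \<^bold>\<and> B) \<longleftrightarrow> modalized p A \<and> modalized p B"
| "modalized p (A \<^bold>\<or> B) \<longleftrightarrow> modalized p A \<and> modalized p B"
| "modalized p (A \<^bold>\<rightarrow> B) \<longleftrightarrow> modalized p A \<and> modalized p B"
| "modalized p (\<^bold>\<box> A) \<longleftrightarrow> True"
| "modalized p (A \<rhd> B) \<longleftrightarrow> True"

definition left_modalized :: "nat \<Rightarrow> fm \<Rightarrow> bool" where
  "left_modalized p A \<longleftrightarrow>
     modalized p A \<and> (\<forall>B C. B \<rhd> C \<in> subfms A \<longrightarrow> p \<notin> vars C)"

text \<open>Boolean evaluation, where \<open>v\<close> treats variables and formulas with a modal main operator as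
  propositional atoms; tautologies are thus all substitution instances of classical
  propositional tautologies.\<close>

primrec bool_eval :: "(fm \<Rightarrow> bool) \<Rightarrow> fm \<Rightarrow> bool" where
  "bool_eval v (Var q) \<longleftrightarrow> v (Var q)"
| "bool_eval v \<^bold>\<bottom> \<longleftrightarrow> False"
| "bool_eval v (\<^bold>\<not> A) \<longleftrightarrow> \<not> bool_eval v A"
| "bool_eval v (A \<^bold>\<and> B) \<longleftrightarrow> bool_eval v A \<and> bool_eval v B"
| "bool_eval v (A \<^bold>\<or> B) \<longleftrightarrow> bool_eval v A \<or> bool_eval v B"
| "bool_eval v (A \<^bold>\<rightarrow> B) \<longleftrightarrow> (bool_eval v A \<longrightarrow> bool_eval v B)"
| "bool_eval v (\<^bold>\<box> A) \<longleftrightarrow> v (\<^bold>\<box> A)"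
| "bool_eval v (A \<rhd> B) \<longleftrightarrow> v (A \<rhd> B)"

definition tautology :: "fm \<Rightarrow> bool" where
  "tautology A \<longleftrightarrow> (\<forall>v. bool_eval v A)"

inductive ILmP :: "fm \<Rightarrow> bool" ("\<turnstile>\<^sub>I\<^sub>L\<^sub>P _" [45] 45) where
  Taut: "tautology A \<Longrightarrow> \<turnstile>\<^sub>I\<^sub>L\<^sub>P A"
| K: "\<turnstile>\<^sub>I\<^sub>L\<^sub>P \<^bold>\<box> (A \<^bold>\<rightarrow> B) \<^bold>\<rightarrow> (\<^bold>\<box> A \<^bold>\<rightarrow> \<^bold>\<box> B)"
| Loeb: "\<turnstile>\<^sub>I\<^sub>L\<^sub>P \<^bold>\<box> (\<^bold>\<box> A \<^bold>\<rightarrow> A) \<^bold>\<rightarrow> \<^bold>\<box> A"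
| J3: "\<turnstile>\<^sub>I\<^sub>L\<^sub>P ((A \<rhd> C) \<^bold>\<and> (B \<rhd> C)) \<^bold>\<rightarrow> ((A \<^bold>\<or> B) \<rhd> C)"
| J6: "\<turnstile>\<^sub>I\<^sub>L\<^sub>P (\<^bold>\<box> A) \<^bold>\<leftrightarrow> ((\<^bold>\<not> A) \<rhd> \<^bold>\<bottom>)"
| P: "\<turnstile>\<^sub>I\<^sub>L\<^sub>P (A \<rhd> B) \<^bold>\<rightarrow> \<^bold>\<box> (A \<rhd> B)"
| MP: "\<turnstile>\<^sub>I\<^sub>L\<^sub>P A \<^bold>\<rightarrow> B \<Longrightarrow> \<turnstile>\<^sub>I\<^sub>L\<^sub>P A \<Longrightarrow> \<turnstile>\<^sub>I\<^sub>L\<^sub>P B"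
| Nec: "\<turnstile>\<^sub>I\<^sub>L\<^sub>P A \<Longrightarrow> \<turnstile>\<^sub>I\<^sub>L\<^sub>P \<^bold>\<box> A"
| R1: "\<turnstile>\<^sub>I\<^sub>L\<^sub>P A \<^bold>\<rightarrow> B \<Longrightarrow> \<turnstile>\<^sub>I\<^sub>L\<^sub>P (C \<rhd> A) \<^bold>\<rightarrow> (C \<rhd> B)"
| R2: "\<turnstile>\<^sub>I\<^sub>L\<^sub>P A \<^bold>\<rightarrow> B \<Longrightarrow> \<turnstile>\<^sub>I\<^sub>L\<^sub>P (B \<rhd> C) \<^bold>\<rightarrow> (A \<rhd> C)"

end

theory Submission
  imports Defs
begin

text \<open>The fixed point of \<open>A\<close> is built by eliminating, one at a time, the modal formulas that
  contain \<open>p\<close> and from which \<open>A\<close> is composed by Boolean connectives. Pick such an \<open>E\<close> and let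
  \<open>A[E := X]\<close> be \<open>A\<close> with \<open>X\<close> in place of \<open>E\<close>. If \<open>X\<close> does not contain \<open>p\<close>, then one modal
  component fewer contains \<open>p\<close>, so by induction there are a fixed point \<open>H\<close> of \<open>A[E := \<top>]\<close> and,
  writing \<open>Q\<close> for \<open>E(H)\<close>, a fixed point \<open>F\<close> of \<open>A[E := Q]\<close>. The formula \<open>F\<close> is a fixed point of
  \<open>A\<close> itself as soon as \<open>Q \<leftrightarrow> E(F)\<close> is provable.

  Two facts about the logic give this equivalence. First, every formula \<open>G\<close> with a modal main
  operator is persistent, \<open>G \<rightarrow> \<box>G\<close>: for \<open>\<rhd>\<close> this is the axiom, and \<open>\<box>B\<close> is equivalent to
  \<open>\<not>B \<rhd> \<bottom>\<close>. With Loeb's axiom, a persistent hypothesis \<open>G\<close> may be kept while assuming \<open>\<box>X\<close>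
  in a proof of \<open>X\<close> (lemma \<open>persistent_Loeb\<close>). Secondly, the left argument of \<open>\<rhd>\<close> may be
  replaced by an argument that is equivalent under \<open>\<box>\<close> (lemma \<open>Rhd_left_mono\<close>), so that boxed
  equivalence of \<open>B\<close> and \<open>C\<close> suffices for \<open>A(B) \<leftrightarrow> A(C)\<close> when \<open>p\<close> is left-modalized in \<open>A\<close>
  (lemma \<open>substitute_cong_modalized\<close>). Right arguments of \<open>\<rhd>\<close> stay as they are, since \<open>p\<close> does
  not occur in them.

  Now under the persistent hypothesis \<open>Q\<close>, the formulas \<open>A[E := \<top>]\<close> and \<open>A[E := Q]\<close> agree, so
  \<open>H\<close> and \<open>F\<close> solve the same equation and coincide by Loeb's axiom. Hence \<open>Q \<rightarrow> \<box>(H \<leftrightarrow> F)\<close>, and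
  \<open>Q\<close>, being \<open>E(H)\<close>, implies \<open>E(F)\<close>. Conversely, assume \<open>E(F)\<close>, which is persistent; by
  Loeb's axiom \<open>\<box>Q\<close> may be assumed too, so again \<open>\<box>(H \<leftrightarrow> F)\<close> and \<open>E(H)\<close> follow
  (lemma \<open>fixed_point_step\<close>).\<close>

section \<open>Derived rules of the logic\<close>

abbreviation Top :: fm ("\<^bold>\<top>") where
  "\<^bold>\<top> \<equiv> \<^bold>\<not> \<^bold>\<bottom>"

lemma taut_mp:
  "\<turnstile>\<^sub>I\<^sub>L\<^sub>P A \<Longrightarrow> tautology (A \<^bold>\<rightarrow> B) \<Longrightarrow> \<turnstile>\<^sub>I\<^sub>L\<^sub>P B"
  by (rule ILmP.MP[OF ILmP.Taut])

lemma taut_mp2: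
  "\<turnstile>\<^sub>I\<^sub>L\<^sub>P A \<Longrightarrow> \<turnstile>\<^sub>I\<^sub>L\<^sub>P B \<Longrightarrow> tautology (A \<^bold>\<rightarrow> B \<^bold>\<rightarrow> C) \<Longrightarrow> \<turnstile>\<^sub>I\<^sub>L\<^sub>P C"
  by (rule ILmP.MP[OF taut_mp])

lemma taut_mp3:
  "\<turnstile>\<^sub>I\<^sub>L\<^sub>P A \<Longrightarrow> \<turnstile>\<^sub>I\<^sub>L\<^sub>P B \<Longrightarrow> \<turnstile>\<^sub>I\<^sub>L\<^sub>P C \<Longrightarrow> tautology (A \<^bold>\<rightarrow> B \<^bold>\<rightarrow> C \<^bold>\<rightarrow> D) \<Longrightarrow> \<turnstile>\<^sub>I\<^sub>L\<^sub>P D"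
  by (rule ILmP.MP[OF taut_mp2])

lemma taut_mp4:
  "\<turnstile>\<^sub>I\<^sub>L\<^sub>P A \<Longrightarrow> \<turnstile>\<^sub>I\<^sub>L\<^sub>P B \<Longrightarrow> \<turnstile>\<^sub>I\<^sub>L\<^sub>P C \<Longrightarrow> \<turnstile>\<^sub>I\<^sub>L\<^sub>P D \<Longrightarrow>
    tautology (A \<^bold>\<rightarrow> B \<^bold>\<rightarrow> C \<^bold>\<rightarrow> D \<^bold>\<rightarrow> E) \<Longrightarrow> \<turnstile>\<^sub>I\<^sub>L\<^sub>P E"
  by (rule ILmP.MP[OF taut_mp3])

lemmas evaluation = tautology_def substitute.simps bool_eval.simps

lemma Box_mono: "\<turnstile>\<^sub>I\<^sub>L\<^sub>P A \<^bold>\<rightarrow> B \<Longrightarrow> \<turnstile>\<^sub>I\<^sub>L\<^sub>P \<^bold>\<box> A \<^bold>\<rightarrow> \<^bold>\<box> B"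
  by (rule ILmP.MP[OF ILmP.K ILmP.Nec])

lemma Box_Con: "\<turnstile>\<^sub>I\<^sub>L\<^sub>P (\<^bold>\<box> A \<^bold>\<and> \<^bold>\<box> B) \<^bold>\<rightarrow> \<^bold>\<box> (A \<^bold>\<and> B)"
proof -
  have "\<turnstile>\<^sub>I\<^sub>L\<^sub>P \<^bold>\<box> A \<^bold>\<rightarrow> \<^bold>\<box> (B \<^bold>\<rightarrow> (A \<^bold>\<and> B))"
    by (rule Box_mono, rule ILmP.Taut) (auto simp: tautology_def)
  from this ILmP.K[of B "A \<^bold>\<and> B"] show ?thesis
    by (rule taut_mp2) (unfold evaluation, rule allI, argo)
qed

text \<open>Transitivity is the persistence axiom for \<open>\<not>A \<rhd> \<bottom>\<close>, to which \<open>\<box>A\<close> is equivalent.\<close>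

lemma Box_persistent: "\<turnstile>\<^sub>I\<^sub>L\<^sub>P \<^bold>\<box> A \<^bold>\<rightarrow> \<^bold>\<box> \<^bold>\<box> A"
proof -
  have "\<turnstile>\<^sub>I\<^sub>L\<^sub>P ((\<^bold>\<not> A) \<rhd> \<^bold>\<bottom>) \<^bold>\<rightarrow> \<^bold>\<box> A"
    by (rule taut_mp[OF ILmP.J6[of A]]) (auto simp: tautology_def)
  from Box_mono[OF this] ILmP.P[of "\<^bold>\<not> A" "\<^bold>\<bottom>"] ILmP.J6[of A] show ?thesis
    by (rule taut_mp3) (unfold evaluation, rule allI, argo)
qed

text \<open>Split \<open>A\<close> into \<open>A \<and> \<not>B\<close> and a part below \<open>B\<close>. The first part interprets \<open>\<bottom>\<close>, hence
  everything, because \<open>\<box>(A \<rightarrow> B)\<close> says so; \<open>J3\<close> joins it with \<open>B\<close>.\<close>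

lemma Rhd_left_mono: "\<turnstile>\<^sub>I\<^sub>L\<^sub>P \<^bold>\<box> (A \<^bold>\<rightarrow> B) \<^bold>\<rightarrow> ((B \<rhd> C) \<^bold>\<rightarrow> (A \<rhd> C))"
proof -
  have "\<turnstile>\<^sub>I\<^sub>L\<^sub>P (\<^bold>\<not> (A \<^bold>\<rightarrow> B) \<rhd> \<^bold>\<bottom>) \<^bold>\<rightarrow> (\<^bold>\<not> (A \<^bold>\<rightarrow> B) \<rhd> C)"
    by (rule ILmP.R1, rule ILmP.Taut) (auto simp: tautology_def)
  moreover have "\<turnstile>\<^sub>I\<^sub>L\<^sub>P ((\<^bold>\<not> (A \<^bold>\<rightarrow> B) \<^bold>\<or> B) \<rhd> C) \<^bold>\<rightarrow> (A \<rhd> C)"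
    by (rule ILmP.R2, rule ILmP.Taut) (auto simp: tautology_def)
  ultimately show ?thesis
    using ILmP.J6[of "A \<^bold>\<rightarrow> B"] ILmP.J3[of "\<^bold>\<not> (A \<^bold>\<rightarrow> B)" C B]
    by (rule taut_mp4) (unfold evaluation, rule allI, argo)
qed

lemma Rhd_left_cong: "\<turnstile>\<^sub>I\<^sub>L\<^sub>P \<^bold>\<box> (A \<^bold>\<leftrightarrow> B) \<^bold>\<rightarrow> ((A \<rhd> C) \<^bold>\<leftrightarrow> (B \<rhd> C))"
proof -
  have "\<turnstile>\<^sub>I\<^sub>L\<^sub>P \<^bold>\<box> (A \<^bold>\<leftrightarrow> B) \<^bold>\<rightarrow> \<^bold>\<box> (A \<^bold>\<rightarrow> B)"
    by (rule Box_mono, rule ILmP.Taut) (auto simp: tautology_def)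
  moreover have "\<turnstile>\<^sub>I\<^sub>L\<^sub>P \<^bold>\<box> (A \<^bold>\<leftrightarrow> B) \<^bold>\<rightarrow> \<^bold>\<box> (B \<^bold>\<rightarrow> A)"
    by (rule Box_mono, rule ILmP.Taut) (auto simp: tautology_def)
  ultimately show ?thesis
    using Rhd_left_mono[of A B C] Rhd_left_mono[of B A C]
    by (rule taut_mp4) (unfold evaluation, rule allI, argo)
qed

lemma Box_cong: "\<turnstile>\<^sub>I\<^sub>L\<^sub>P \<^bold>\<box> (A \<^bold>\<leftrightarrow> B) \<^bold>\<rightarrow> (\<^bold>\<box> A \<^bold>\<leftrightarrow> \<^bold>\<box> B)"
proof -
  have "\<turnstile>\<^sub>I\<^sub>L\<^sub>P \<^bold>\<box> (A \<^bold>\<leftrightarrow> B) \<^bold>\<rightarrow> \<^bold>\<box> (A \<^bold>\<rightarrow> B)"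
    by (rule Box_mono, rule ILmP.Taut) (auto simp: tautology_def)
  moreover have "\<turnstile>\<^sub>I\<^sub>L\<^sub>P \<^bold>\<box> (A \<^bold>\<leftrightarrow> B) \<^bold>\<rightarrow> \<^bold>\<box> (B \<^bold>\<rightarrow> A)"
    by (rule Box_mono, rule ILmP.Taut) (auto simp: tautology_def)
  ultimately show ?thesis
    using ILmP.K[of A B] ILmP.K[of B A]
    by (rule taut_mp4) (unfold evaluation, rule allI, argo)
qed

text \<open>Loeb's rule for the formula \<open>Q \<rightarrow> X\<close>: its box and \<open>Q\<close> itself yield \<open>\<box>X\<close>, since \<open>Q\<close>
  yields \<open>\<box>Q\<close>.\<close>

lemma persistent_Loeb:
  assumes persistent: "\<turnstile>\<^sub>I\<^sub>L\<^sub>P Q \<^bold>\<rightarrow> \<^bold>\<box> Q"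
    and step: "\<turnstile>\<^sub>I\<^sub>L\<^sub>P (Q \<^bold>\<and> \<^bold>\<box> X) \<^bold>\<rightarrow> X"
  shows "\<turnstile>\<^sub>I\<^sub>L\<^sub>P Q \<^bold>\<rightarrow> X"
proof -
  from persistent step ILmP.K[of Q X]
  have "\<turnstile>\<^sub>I\<^sub>L\<^sub>P \<^bold>\<box> (Q \<^bold>\<rightarrow> X) \<^bold>\<rightarrow> (Q \<^bold>\<rightarrow> X)"
    by (rule taut_mp3) (unfold evaluation, rule allI, argo)
  with ILmP.MP[OF ILmP.Loeb ILmP.Nec] show ?thesis
    by (blast intro: ILmP.MP)
qed

section \<open>Substitution of equivalent formulas\<close>

lemma substitute_notin_vars [simp]: "p \<notin> vars A \<Longrightarrow> substitute p F A = A"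
  by (induction A) auto

lemma vars_substitute: "vars (substitute p F A) \<subseteq> (vars A - {p}) \<union> vars F"
  by (induction A) auto

lemma notin_vars_modalized: "p \<notin> vars A \<Longrightarrow> modalized p A"
  by (induction A) auto

text \<open>Left-modalization without the requirement that \<open>p\<close> be modalized: this weaker condition
  passes to subformulas, which induction on formulas needs.\<close>

primrec left_only :: "nat \<Rightarrow> fm \<Rightarrow> bool" where
  "left_only p (Var q) \<longleftrightarrow> True"
| "left_only p \<^bold>\<bottom> \<longleftrightarrow> True"
| "left_only p (\<^bold>\<not> A) \<longleftrightarrow> left_only p A"
| "left_only p (A \<^bold>\<and> B) \<longleftrightarrow> left_only p A \<and> left_only p B"
| "left_only p (A \<^bold>\<or> B) \<longleftrightarrow> left_only p A \<and> left_only p B"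
| "left_only p (A \<^bold>\<rightarrow> B) \<longleftrightarrow> left_only p A \<and> left_only p B"
| "left_only p (\<^bold>\<box> A) \<longleftrightarrow> left_only p A"
| "left_only p (A \<rhd> B) \<longleftrightarrow> left_only p A \<and> p \<notin> vars B"

lemma notin_vars_left_only: "p \<notin> vars A \<Longrightarrow> left_only p A"
  by (induction A) auto

lemma left_only_if_subfms:
  "(\<forall>B C. B \<rhd> C \<in> subfms A \<longrightarrow> p \<notin> vars C) \<Longrightarrow> left_only p A"
  by (induction A) auto

lemma Box_Iff_if_Iff:
  assumes "\<turnstile>\<^sub>I\<^sub>L\<^sub>P (D \<^bold>\<and> \<^bold>\<box> D) \<^bold>\<rightarrow> (X \<^bold>\<leftrightarrow> Y)"
  shows "\<turnstile>\<^sub>I\<^sub>L\<^sub>P \<^bold>\<box> D \<^bold>\<rightarrow> \<^bold>\<box> (X \<^bold>\<leftrightarrow> Y)"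
  using Box_mono[OF assms] Box_Con[of D "\<^bold>\<box> D"] Box_persistent[of D]
  by (rule taut_mp3) (unfold evaluation, rule allI, argo)

lemma substitute_cong_Box:
  assumes "\<turnstile>\<^sub>I\<^sub>L\<^sub>P (D \<^bold>\<and> \<^bold>\<box> D) \<^bold>\<rightarrow> (substitute p B A \<^bold>\<leftrightarrow> substitute p C A)"
  shows "\<turnstile>\<^sub>I\<^sub>L\<^sub>P \<^bold>\<box> D \<^bold>\<rightarrow> (substitute p B (\<^bold>\<box> A) \<^bold>\<leftrightarrow> substitute p C (\<^bold>\<box> A))"
  using Box_Iff_if_Iff[OF assms] Box_cong[of "substitute p B A" "substitute p C A"]
  by (rule taut_mp2) (unfold evaluation, rule allI, argo)

lemma substitute_cong_Rhd:
  assumes "\<turnstile>\<^sub>I\<^sub>L\<^sub>P (D \<^bold>\<and> \<^bold>\<box> D) \<^bold>\<rightarrow> (substitute p B A \<^bold>\<leftrightarrow> substitute p C A)"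
    and "p \<notin> vars A'"
  shows "\<turnstile>\<^sub>I\<^sub>L\<^sub>P \<^bold>\<box> D \<^bold>\<rightarrow> (substitute p B (A \<rhd> A') \<^bold>\<leftrightarrow> substitute p C (A \<rhd> A'))"
  using Box_Iff_if_Iff[OF assms(1)] Rhd_left_cong[of "substitute p B A" "substitute p C A" A']
  by (rule taut_mp2) (use assms(2) in \<open>auto simp: tautology_def\<close>)

text \<open>The box in the hypothesis serves the occurrences of \<open>p\<close> under modal operators. There,
  transitivity restores the whole hypothesis inside the box.\<close>

lemma substitute_cong:
  assumes "left_only p A"
  shows "\<turnstile>\<^sub>I\<^sub>L\<^sub>P ((B \<^bold>\<leftrightarrow> C) \<^bold>\<and> \<^bold>\<box> (B \<^bold>\<leftrightarrow> C)) \<^bold>\<rightarrow> (substitute p B A \<^bold>\<leftrightarrow> substitute p C A)"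
  using assms
proof (induction A)
  case (Var q)
  show ?case by (rule ILmP.Taut) (auto simp: tautology_def)
next
  case Bot
  show ?case by (rule ILmP.Taut) (auto simp: tautology_def)
next
  case (Neg A)
  then have "\<turnstile>\<^sub>I\<^sub>L\<^sub>P ((B \<^bold>\<leftrightarrow> C) \<^bold>\<and> \<^bold>\<box> (B \<^bold>\<leftrightarrow> C)) \<^bold>\<rightarrow> (substitute p B A \<^bold>\<leftrightarrow> substitute p C A)"
    by simp
  then show ?case by (rule taut_mp) (auto simp: tautology_def)
next
  case (Con A1 A2)
  then have "left_only p A1" "left_only p A2"
    by simp_all
  from Con.IH(1)[OF this(1)] Con.IH(2)[OF this(2)] show ?case
    by (rule taut_mp2) (unfold evaluation, rule allI, argo)
next
  case (Dis A1 A2)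
  then have "left_only p A1" "left_only p A2"
    by simp_all
  from Dis.IH(1)[OF this(1)] Dis.IH(2)[OF this(2)] show ?case
    by (rule taut_mp2) (unfold evaluation, rule allI, argo)
next
  case (Imp A1 A2)
  then have "left_only p A1" "left_only p A2"
    by simp_all
  from Imp.IH(1)[OF this(1)] Imp.IH(2)[OF this(2)] show ?case
    by (rule taut_mp2) (unfold evaluation, rule allI, argo)
next
  case (Box A)
  then have "\<turnstile>\<^sub>I\<^sub>L\<^sub>P \<^bold>\<box> (B \<^bold>\<leftrightarrow> C) \<^bold>\<rightarrow> (substitute p B (\<^bold>\<box> A) \<^bold>\<leftrightarrow> substitute p C (\<^bold>\<box> A))"
    by (intro substitute_cong_Box) simp
  then show ?case by (rule taut_mp) (auto simp: tautology_def)
next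
  case (Rhd A1 A2)
  then have "\<turnstile>\<^sub>I\<^sub>L\<^sub>P \<^bold>\<box> (B \<^bold>\<leftrightarrow> C) \<^bold>\<rightarrow> (substitute p B (A1 \<rhd> A2) \<^bold>\<leftrightarrow> substitute p C (A1 \<rhd> A2))"
    by (intro substitute_cong_Rhd) simp_all
  then show ?case by (rule taut_mp) (auto simp: tautology_def)
qed

text \<open>It is because the unboxed hypothesis is dropped here that Loeb's axiom makes fixed points
  of modalized formulas unique.\<close>

lemma substitute_cong_modalized:
  assumes "left_only p A" and "modalized p A"
  shows "\<turnstile>\<^sub>I\<^sub>L\<^sub>P \<^bold>\<box> (B \<^bold>\<leftrightarrow> C) \<^bold>\<rightarrow> (substitute p B A \<^bold>\<leftrightarrow> substitute p C A)"
  using assms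
proof (induction A)
  case (Var q)
  then show ?case by (intro ILmP.Taut) (auto simp: tautology_def)
next
  case Bot
  show ?case by (rule ILmP.Taut) (auto simp: tautology_def)
next
  case (Neg A)
  then have "\<turnstile>\<^sub>I\<^sub>L\<^sub>P \<^bold>\<box> (B \<^bold>\<leftrightarrow> C) \<^bold>\<rightarrow> (substitute p B A \<^bold>\<leftrightarrow> substitute p C A)"
    by simp
  then show ?case by (rule taut_mp) (auto simp: tautology_def)
next
  case (Con A1 A2)
  then have "left_only p A1" "left_only p A2" "modalized p A1" "modalized p A2"
    by simp_all
  from Con.IH(1)[OF this(1,3)] Con.IH(2)[OF this(2,4)] show ?case
    by (rule taut_mp2) (unfold evaluation, rule allI, argo)
next
  case (Dis A1 A2)
  then have "left_only p A1" "left_only p A2" "modalized p A1" "modalized p A2"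
    by simp_all
  from Dis.IH(1)[OF this(1,3)] Dis.IH(2)[OF this(2,4)] show ?case
    by (rule taut_mp2) (unfold evaluation, rule allI, argo)
next
  case (Imp A1 A2)
  then have "left_only p A1" "left_only p A2" "modalized p A1" "modalized p A2"
    by simp_all
  from Imp.IH(1)[OF this(1,3)] Imp.IH(2)[OF this(2,4)] show ?case
    by (rule taut_mp2) (unfold evaluation, rule allI, argo)
next
  case (Box A)
  then show ?case
    by (intro substitute_cong_Box substitute_cong) simp
next
  case (Rhd A1 A2)
  then show ?case
    by (intro substitute_cong_Rhd substitute_cong) simp_all
qed

section \<open>Modal components\<close>

primrec modal_components :: "fm \<Rightarrow> fm set" where
  "modal_components (Var q) = {}"
| "modal_components \<^bold>\<bottom> = {}"
| "modal_components (\<^bold>\<not> A) = modal_components A"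
| "modal_components (A \<^bold>\<and> B) = modal_components A \<union> modal_components B"
| "modal_components (A \<^bold>\<or> B) = modal_components A \<union> modal_components B"
| "modal_components (A \<^bold>\<rightarrow> B) = modal_components A \<union> modal_components B"
| "modal_components (\<^bold>\<box> A) = {\<^bold>\<box> A}"
| "modal_components (A \<rhd> B) = {A \<rhd> B}"

primrec replace_component :: "fm \<Rightarrow> fm \<Rightarrow> fm \<Rightarrow> fm" where
  "replace_component E X (Var q) = Var q"
| "replace_component E X \<^bold>\<bottom> = \<^bold>\<bottom>"
| "replace_component E X (\<^bold>\<not> A) = \<^bold>\<not> (replace_component E X A)"
| "replace_component E X (A \<^bold>\<and> B) = replace_component E X A \<^bold>\<and> replace_component E X B"
| "replace_component E X (A \<^bold>\<or> B) = replace_component E X A \<^bold>\<or> replace_component E X B"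
| "replace_component E X (A \<^bold>\<rightarrow> B) = replace_component E X A \<^bold>\<rightarrow> replace_component E X B"
| "replace_component E X (\<^bold>\<box> A) = (if \<^bold>\<box> A = E then X else \<^bold>\<box> A)"
| "replace_component E X (A \<rhd> B) = (if A \<rhd> B = E then X else A \<rhd> B)"

lemma finite_modal_components: "finite (modal_components A)"
  by (induction A) auto

lemma modal_components_vars: "E \<in> modal_components A \<Longrightarrow> vars E \<subseteq> vars A"
  by (induction A) auto

lemma modal_components_modalized: "E \<in> modal_components A \<Longrightarrow> modalized p E"
  by (induction A) auto

lemma modal_components_left_only:
  "E \<in> modal_components A \<Longrightarrow> left_only p A \<Longrightarrow> left_only p E"
  by (induction A) auto

lemma modal_components_persistent:
  "E \<in> modal_components A \<Longrightarrow> \<turnstile>\<^sub>I\<^sub>L\<^sub>P substitute p F E \<^bold>\<rightarrow> \<^bold>\<box> (substitute p F E)"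
  by (induction A) (auto intro: Box_persistent ILmP.P)

lemma notin_vars_if_notin_components:
  "modalized p A \<Longrightarrow> (\<forall>E \<in> modal_components A. p \<notin> vars E) \<Longrightarrow> p \<notin> vars A"
  by (induction A) auto

lemma replace_component_self: "replace_component E E A = A"
  by (induction A) auto

lemma vars_replace_component: "vars (replace_component E X A) \<subseteq> vars A \<union> vars X"
  by (induction A) auto

lemma modalized_replace_component:
  "modalized p A \<Longrightarrow> modalized p X \<Longrightarrow> modalized p (replace_component E X A)"
  by (induction A) auto

lemma left_only_replace_component:
  "left_only p A \<Longrightarrow> left_only p X \<Longrightarrow> left_only p (replace_component E X A)"
  by (induction A) auto

lemma modal_components_replace:
  "modal_components (replace_component E X A) \<subseteq> (modal_components A - {E}) \<union> modal_components X"
  by (induction A) auto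

lemma replace_component_cong:
  "\<turnstile>\<^sub>I\<^sub>L\<^sub>P (substitute p F X \<^bold>\<leftrightarrow> substitute p F Y) \<^bold>\<rightarrow>
    (substitute p F (replace_component E X A) \<^bold>\<leftrightarrow> substitute p F (replace_component E Y A))"
proof (induction A)
  case (Neg A)
  then show ?case by (rule taut_mp) (auto simp: tautology_def)
next
  case (Con A1 A2)
  then show ?case
    by (rule taut_mp2) (unfold evaluation replace_component.simps, rule allI, argo)
next
  case (Dis A1 A2)
  then show ?case
    by (rule taut_mp2) (unfold evaluation replace_component.simps, rule allI, argo)
next
  case (Imp A1 A2)
  then show ?case
    by (rule taut_mp2) (unfold evaluation replace_component.simps, rule allI, argo)
qed (rule ILmP.Taut, auto simp: tautology_def)+

text \<open>The measure for the induction. It counts formulas and not occurrences, because all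
  occurrences of a component are replaced at once.\<close>

abbreviation component_count :: "nat \<Rightarrow> fm \<Rightarrow> nat" where
  "component_count p A \<equiv> card {E \<in> modal_components A. p \<in> vars E}"

lemma component_count_replace:
  assumes E: "E \<in> modal_components A" "p \<in> vars E" and X: "p \<notin> vars X"
  shows "component_count p (replace_component E X A) < component_count p A"
proof (rule psubset_card_mono)
  show "finite {E \<in> modal_components A. p \<in> vars E}"
    using finite_modal_components by simp
  show "{E' \<in> modal_components (replace_component E X A). p \<in> vars E'}
      \<subset> {E \<in> modal_components A. p \<in> vars E}"
    using modal_components_replace[of E X A] modal_components_vars[of _ X] E X by blast
qed

section \<open>Existence of fixed points\<close>

text \<open>Uniqueness of fixed points relative to \<open>Q\<close>, that is \<open>Q \<rightarrow> (H \<leftrightarrow> F)\<close>, serves twice: boxed,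
  it gives \<open>E(H) \<leftrightarrow> E(F)\<close> from \<open>\<box>Q\<close>, and \<open>\<box>Q\<close> is at hand both under \<open>Q\<close>, by persistence, and
  under \<open>E(F)\<close>, by Loeb's axiom. As \<open>p\<close> is not in \<open>Q\<close>, substituting \<open>F\<close> leaves \<open>Q\<close> unchanged, so
  \<open>Q \<leftrightarrow> E(F)\<close> turns the equation for \<open>F\<close> into the one that \<open>A\<close> demands.\<close>

lemma fixed_point_step:
  assumes A: "left_only p A" "modalized p A" and E: "E \<in> modal_components A"
    and Q_def: "Q = substitute p H E" and Q: "p \<notin> vars Q"
    and H: "\<turnstile>\<^sub>I\<^sub>L\<^sub>P H \<^bold>\<leftrightarrow> substitute p H (replace_component E \<^bold>\<top> A)"
    and F: "\<turnstile>\<^sub>I\<^sub>L\<^sub>P F \<^bold>\<leftrightarrow> substitute p F (replace_component E Q A)"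
  shows "\<turnstile>\<^sub>I\<^sub>L\<^sub>P F \<^bold>\<leftrightarrow> substitute p F A"
proof -
  define G where "G = substitute p F E"
  have Q_persistent: "\<turnstile>\<^sub>I\<^sub>L\<^sub>P Q \<^bold>\<rightarrow> \<^bold>\<box> Q"
    unfolding Q_def by (rule modal_components_persistent[OF E])
  have G_persistent: "\<turnstile>\<^sub>I\<^sub>L\<^sub>P G \<^bold>\<rightarrow> \<^bold>\<box> G"
    unfolding G_def by (rule modal_components_persistent[OF E])
  have E_cong: "\<turnstile>\<^sub>I\<^sub>L\<^sub>P \<^bold>\<box> (H \<^bold>\<leftrightarrow> F) \<^bold>\<rightarrow> (Q \<^bold>\<leftrightarrow> G)"
    unfolding Q_def G_def
    by (rule substitute_cong_modalized[OF modal_components_left_only[OF E A(1)]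
        modal_components_modalized[OF E]])
  \<comment> \<open>Given \<open>Q\<close>, both \<open>H\<close> and \<open>F\<close> are fixed points of the formula with \<open>\<top>\<close> for \<open>E\<close>; the boxed
    equivalence carries one equation into the other.\<close>
  have "\<turnstile>\<^sub>I\<^sub>L\<^sub>P (Q \<^bold>\<and> \<^bold>\<box> (H \<^bold>\<leftrightarrow> F)) \<^bold>\<rightarrow> (H \<^bold>\<leftrightarrow> F)"
  proof -
    have "left_only p (replace_component E \<^bold>\<top> A)" "modalized p (replace_component E \<^bold>\<top> A)"
      using A left_only_replace_component modalized_replace_component by simp_all
    then have "\<turnstile>\<^sub>I\<^sub>L\<^sub>P \<^bold>\<box> (H \<^bold>\<leftrightarrow> F) \<^bold>\<rightarrow> (substitute p H (replace_component E \<^bold>\<top> A)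
        \<^bold>\<leftrightarrow> substitute p F (replace_component E \<^bold>\<top> A))"
      by (rule substitute_cong_modalized)
    moreover have "\<turnstile>\<^sub>I\<^sub>L\<^sub>P Q \<^bold>\<rightarrow> (substitute p F (replace_component E \<^bold>\<top> A)
        \<^bold>\<leftrightarrow> substitute p F (replace_component E Q A))"
      by (rule taut_mp[OF replace_component_cong[of p F "\<^bold>\<top>" Q E A]])
        (use Q in \<open>simp add: tautology_def\<close>)
    ultimately show ?thesis
      using H F by (rule taut_mp4) (unfold evaluation, rule allI, argo)
  qed
  with Q_persistent have unique: "\<turnstile>\<^sub>I\<^sub>L\<^sub>P Q \<^bold>\<rightarrow> (H \<^bold>\<leftrightarrow> F)"
    by (rule persistent_Loeb)
  have Q_G: "\<turnstile>\<^sub>I\<^sub>L\<^sub>P Q \<^bold>\<rightarrow> G"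
    using Q_persistent Box_mono[OF unique] E_cong
    by (rule taut_mp3) (unfold evaluation, rule allI, argo)
  have "\<turnstile>\<^sub>I\<^sub>L\<^sub>P (G \<^bold>\<and> \<^bold>\<box> Q) \<^bold>\<rightarrow> Q"
    using Box_mono[OF unique] E_cong
    by (rule taut_mp2) (unfold evaluation, rule allI, argo)
  with G_persistent have G_Q: "\<turnstile>\<^sub>I\<^sub>L\<^sub>P G \<^bold>\<rightarrow> Q"
    by (rule persistent_Loeb)
  have "\<turnstile>\<^sub>I\<^sub>L\<^sub>P (Q \<^bold>\<leftrightarrow> G) \<^bold>\<rightarrow> (substitute p F (replace_component E Q A) \<^bold>\<leftrightarrow> substitute p F A)"
    using replace_component_cong[of p F Q E E A] Q
    by (simp add: G_def replace_component_self)
  from this Q_G G_Q F show ?thesis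
    by (rule taut_mp4) (unfold evaluation, rule allI, argo)
qed

theorem theorem2p4:
  fixes p :: nat and A :: fm
  assumes "left_modalized p A"
  shows "\<exists>F :: fm. vars F \<subseteq> vars A - {p} \<and> (\<turnstile>\<^sub>I\<^sub>L\<^sub>P F \<^bold>\<leftrightarrow> substitute p F A)"
proof -
  have "left_only p A" and "modalized p A"
    using assms left_only_if_subfms unfolding left_modalized_def by auto
  then show ?thesis
  proof (induction "component_count p A" arbitrary: A rule: less_induct)
    case (less A)
    show ?case
    proof (cases "\<forall>E \<in> modal_components A. p \<notin> vars E")
      case True
      then have "p \<notin> vars A"
        using notin_vars_if_notin_components less.prems by blast
      moreover have "\<turnstile>\<^sub>I\<^sub>L\<^sub>P A \<^bold>\<leftrightarrow> A"
        by (rule ILmP.Taut) (auto simp: tautology_def)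
      ultimately show ?thesis by (intro exI[of _ A]) simp
    next
      case False
      then obtain E where E: "E \<in> modal_components A" "p \<in> vars E"
        by blast
      have IH: "\<exists>F. vars F \<subseteq> vars A \<union> vars X - {p} \<and>
          (\<turnstile>\<^sub>I\<^sub>L\<^sub>P F \<^bold>\<leftrightarrow> substitute p F (replace_component E X A))" if "p \<notin> vars X" for X
      proof -
        have "left_only p (replace_component E X A)" "modalized p (replace_component E X A)"
          using less.prems that left_only_replace_component modalized_replace_component
            notin_vars_left_only notin_vars_modalized by blast+
        from less.hyps[OF component_count_replace[OF E that] this] show ?thesis
          using vars_replace_component[of E X A] by blast
      qed
      obtain H where H: "vars H \<subseteq> vars A - {p}"
          "\<turnstile>\<^sub>I\<^sub>L\<^sub>P H \<^bold>\<leftrightarrow> substitute p H (replace_component E \<^bold>\<top> A)"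
        using IH[of "\<^bold>\<top>"] by auto
      define Q where "Q = substitute p H E"
      have Q: "vars Q \<subseteq> vars A - {p}"
        using vars_substitute[of p H E] modal_components_vars[OF E(1)] H(1) Q_def by blast
      then obtain F where F: "vars F \<subseteq> vars A - {p}"
          "\<turnstile>\<^sub>I\<^sub>L\<^sub>P F \<^bold>\<leftrightarrow> substitute p F (replace_component E Q A)"
        using IH[of Q] by blast
      have "p \<notin> vars Q"
        using Q by blast
      from fixed_point_step[OF less.prems E(1) Q_def this H(2) F(2)]
      have "\<turnstile>\<^sub>I\<^sub>L\<^sub>P F \<^bold>\<leftrightarrow> substitute p F A" .
      with F(1) show ?thesis by blast
    qed
  qed
qed

end
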